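(* Let $S=\sum_{i=1}^n y_i\frac{\partial}{\partial x_i}-2\sum_{a=1}^n G^a(x,y)\frac{\partial}{\partial y_a}$ be a spray on $\mathbb{R}^n$ (a vector field on $T\mathbb{R}^n$), and let $HT\mathbb{R}^n\subset T(T\mathbb{R}^n)$ be the horizontal distribution associated to $S$. Suppose there exist a smooth two-form $\omega$ on $T\mathbb{R}^n$ and a closed one-form $\alpha$ on $T\mathbb{R}^n$ such that $$\alpha-i_S\omega\in (HT\mathbb{R}^n)^\circ .$$ Then a function $H\in C^\infty(T\mathbb{R}^n)$ with $dH=\alpha$ is a constant of motion for $S$. Furthermore, if $S$ is $R$-flat, i.e. the distribution $HT\mathbb{R}^n$ is integrable, and $\omega$ is closed, then $$L=\{(X,\beta)\,|\, X\in HT\mathbb{R}^n,\ \ \beta-i_X\omega\in (HT\mathbb{R}^n)^\circ\}$$ is a Dirac structure on $T\mathbb{R}^n$ and $S$ is Hamiltonian with respect to $L$.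
   Context: Coordinates $(x_1,\dots,x_n)$ on $\mathbb{R}^n$ induce coordinates $(x_1,\dots,x_n,y_1,\dots,y_n)$ on $T\mathbb{R}^n=\mathbb{R}^n\times\mathbb{R}^n$. A semi-spray on $\mathbb{R}^n$ is a vector field on $T\mathbb{R}^n$ of the form $S=\sum_{i} y_i\frac{\partial}{\partial x_i}-2\sum_{a} G^a(x,y)\frac{\partial}{\partial y_a}$ with $G^a$ smooth functions. It is a spray if $G^a(x,\lambda y)=\lambda^2G^a(x,y)$ for all $\lambda>0$ and all $a$. The horizontal distribution $HT\mathbb{R}^n$ associated to $S$ is the rank-$n$ distribution on $T\mathbb{R}^n$ spanned by $\frac{\delta}{\delta x_i}=\frac{\partial}{\partial x_i}-\sum_{a=1}^n\frac{\partial G^a}{\partial y_i}\frac{\partial}{\partial y_a}$, $i=1,\dots,n$. For a distribution $D$, $D^\circ$ denotes its annihilator in the cotangent bundle, and $i_X\omega(Y)=\omega(X,Y)$. Membership such as $\alpha\in D^\circ$ or $X\in D$ means being a section. A constant of motion for $S$ is a function $H$ with $S(H)=0$. Dirac structures: on a manifold $M$, the bundle $\mathbb{T}M=TM\oplus T^*M$ carries the pairing $\langle (X,\alpha),(Y,\beta)\rangle=\beta(X)+\alpha(Y)$ and the Courant bracket $[\![(X,\alpha),(Y,\beta)]\!]=\big([X,Y],\ \mathcal{L}_X\beta-\mathcal{L}_Y\alpha+\tfrac12 d(\alpha(Y)-\beta(X))\big)$. A linear subbundle $L\subset\mathbb{T}M$ is an almost Dirac structure if $L=L^\perp$ with respect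 to the pairing, and a Dirac structure if moreover its sections are closed under the Courant bracket. A vector field $X$ is Hamiltonian with respect to $L$ if there is a smooth function $K$ such that $(X,dK)$ is a section of $L$. *)

theory Defs
  imports "HOL-Analysis.Analysis"
begin

text \<open>The second argument is meant to be an open subset of a finite-dimensional space, where
  differentiability together with \<open>C\<^sup>k\<close> directional derivatives in every direction is the
  same as \<open>C\<^sup>k\<^sup>+\<^sup>1\<close>.\<close>

primrec Ck_on :: "nat \<Rightarrow> 'a::euclidean_space set \<Rightarrow> ('a \<Rightarrow> 'b::real_normed_vector) \<Rightarrow> bool" where
  "Ck_on 0 U f \<longleftrightarrow> continuous_on U f"
| "Ck_on (Suc k) U f \<longleftrightarrow> (\<forall>x\<in>U. f differentiable (at x)) \<and>
     (\<forall>v. Ck_on k U (\<lambda>x. frechet_derivative f (at x) v))"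

definition smooth_on :: "'a::euclidean_space set \<Rightarrow> ('a \<Rightarrow> 'b::real_normed_vector) \<Rightarrow> bool" where
  "smooth_on U f \<longleftrightarrow> (\<forall>k. Ck_on k U f)"

abbreviation smooth :: "('a::euclidean_space \<Rightarrow> 'b::real_normed_vector) \<Rightarrow> bool" where
  "smooth \<equiv> smooth_on UNIV"

text \<open>The manifold is a whole Euclidean space \<open>'m\<close>, whose tangent bundle is trivial: vector fields
  are maps \<open>'m \<Rightarrow> 'm\<close>, and the cotangent space at each point is the space of (automatically
  bounded) linear functionals on \<open>'m\<close>. A two-form is stored curried, so that \<open>\<omega> p (X p)\<close> is
  the value at \<open>p\<close> of the one-form \<open>i\<^sub>X\<omega>\<close>.\<close>

type_synonym 'm covector = "'m \<Rightarrow>\<^sub>L real"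
type_synonym 'm bilin = "'m \<Rightarrow>\<^sub>L 'm \<Rightarrow>\<^sub>L real"

definition one_form :: "('m::euclidean_space \<Rightarrow> 'm covector) \<Rightarrow> bool" where
  "one_form \<alpha> \<longleftrightarrow> smooth \<alpha>"

definition two_form :: "('m::euclidean_space \<Rightarrow> 'm bilin) \<Rightarrow> bool" where
  "two_form \<omega> \<longleftrightarrow> smooth \<omega> \<and> (\<forall>p u. blinfun_apply (blinfun_apply (\<omega> p) u) u = 0)"

definition contract :: "('m::euclidean_space \<Rightarrow> 'm) \<Rightarrow> ('m \<Rightarrow> 'm bilin) \<Rightarrow> 'm \<Rightarrow> 'm covector" where
  "contract X \<omega> = (\<lambda>p. blinfun_apply (\<omega> p) (X p))"

definition d_fun :: "('m::euclidean_space \<Rightarrow> real) \<Rightarrow> 'm \<Rightarrow> 'm covector" where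
  "d_fun f = (\<lambda>p. Blinfun (frechet_derivative f (at p)))"

definition lie_fun :: "('m::euclidean_space \<Rightarrow> 'm) \<Rightarrow> ('m \<Rightarrow> real) \<Rightarrow> 'm \<Rightarrow> real" where
  "lie_fun X f = (\<lambda>p. frechet_derivative f (at p) (X p))"

text \<open>Exterior derivatives evaluated on constant vector fields, for which all Lie brackets
  vanish.\<close>

definition d_one :: "('m::euclidean_space \<Rightarrow> 'm covector) \<Rightarrow> 'm \<Rightarrow> 'm \<Rightarrow> 'm \<Rightarrow> real" where
  "d_one \<alpha> p u v =
     blinfun_apply (frechet_derivative \<alpha> (at p) u) v - blinfun_apply (frechet_derivative \<alpha> (at p) v) u"

definition d_two :: "('m::euclidean_space \<Rightarrow> 'm bilin) \<Rightarrow> 'm \<Rightarrow> 'm \<Rightarrow> 'm \<Rightarrow> 'm \<Rightarrow> real" where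
  "d_two \<omega> p u v w =
     blinfun_apply (blinfun_apply (frechet_derivative \<omega> (at p) u) v) w
     - blinfun_apply (blinfun_apply (frechet_derivative \<omega> (at p) v) u) w
     + blinfun_apply (blinfun_apply (frechet_derivative \<omega> (at p) w) u) v"

definition closed_one_form :: "('m::euclidean_space \<Rightarrow> 'm covector) \<Rightarrow> bool" where
  "closed_one_form \<alpha> \<longleftrightarrow> one_form \<alpha> \<and> (\<forall>p u v. d_one \<alpha> p u v = 0)"

definition closed_two_form :: "('m::euclidean_space \<Rightarrow> 'm bilin) \<Rightarrow> bool" where
  "closed_two_form \<omega> \<longleftrightarrow> two_form \<omega> \<and> (\<forall>p u v w. d_two \<omega> p u v w = 0)"

definition lie_bracket :: "('m::euclidean_space \<Rightarrow> 'm) \<Rightarrow> ('m \<Rightarrow> 'm) \<Rightarrow> 'm \<Rightarrow> 'm" where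
  "lie_bracket X Y =
     (\<lambda>p. frechet_derivative Y (at p) (X p) - frechet_derivative X (at p) (Y p))"

text \<open>In coordinates,
  \<open>(\<L>\<^sub>X\<beta>)\<^sub>i = \<Sum>\<^sub>j X\<^sub>j \<partial>\<^sub>j\<beta>\<^sub>i + \<Sum>\<^sub>j \<beta>\<^sub>j \<partial>\<^sub>iX\<^sub>j\<close>.\<close>

definition lie_form :: "('m::euclidean_space \<Rightarrow> 'm) \<Rightarrow> ('m \<Rightarrow> 'm covector) \<Rightarrow> 'm \<Rightarrow> 'm covector" where
  "lie_form X \<beta> =
     (\<lambda>p. frechet_derivative \<beta> (at p) (X p) + (\<beta> p o\<^sub>L Blinfun (frechet_derivative X (at p))))"

text \<open>A subbundle of a trivial bundle is given by its family of fibres.\<close>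

definition smooth_subbundle :: "('m::euclidean_space \<Rightarrow> 'v::real_normed_vector set) \<Rightarrow> bool" where
  "smooth_subbundle E \<longleftrightarrow> (\<exists>k. \<forall>p. \<exists>U s. open U \<and> p \<in> U \<and>
     (\<forall>i<k. smooth_on U (s i)) \<and>
     (\<forall>q\<in>U. inj_on (\<lambda>i::nat. s i q) {..<k} \<and> independent ((\<lambda>i. s i q) ` {..<k}) \<and>
        span ((\<lambda>i. s i q) ` {..<k}) = E q))"

definition is_section :: "('m::euclidean_space \<Rightarrow> 'v::real_normed_vector set) \<Rightarrow> ('m \<Rightarrow> 'v) \<Rightarrow> bool" where
  "is_section E s \<longleftrightarrow> smooth s \<and> (\<forall>p. s p \<in> E p)"

definition annihilator :: "('m::euclidean_space \<Rightarrow> 'm set) \<Rightarrow> 'm \<Rightarrow> 'm covector set" where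
  "annihilator D = (\<lambda>p. {\<beta>. \<forall>v\<in>D p. blinfun_apply \<beta> v = 0})"

text \<open>\<open>\<phi>\<close> is an injective immersion, so \<open>\<phi> ` V\<close> is an immersed submanifold; its
  tangent space at \<open>\<phi> v\<close> is the range of the derivative of \<open>\<phi>\<close> at \<open>v\<close>.\<close>

definition parametrizes_integral_manifold ::
  "'k::euclidean_space set \<Rightarrow> ('k \<Rightarrow> 'm::euclidean_space) \<Rightarrow> ('m \<Rightarrow> 'm set) \<Rightarrow> bool" where
  "parametrizes_integral_manifold V \<phi> D \<longleftrightarrow> open V \<and> smooth_on V \<phi> \<and> inj_on \<phi> V \<and>
     (\<forall>v\<in>V. inj (frechet_derivative \<phi> (at v)) \<and> range (frechet_derivative \<phi> (at v)) = D (\<phi> v))"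

text \<open>Integrability of a distribution of rank \<open>CARD('n)\<close>: there is an integral manifold through
  every point (it may be shrunk to the image of a single local parametrization).\<close>

definition integrable_distribution ::
  "((real^'n) \<times> (real^'n) \<Rightarrow> ((real^'n) \<times> (real^'n)) set) \<Rightarrow> bool" where
  "integrable_distribution D \<longleftrightarrow>
     (\<forall>p. \<exists>V (\<phi> :: real^'n \<Rightarrow> _). parametrizes_integral_manifold V \<phi> D \<and> p \<in> \<phi> ` V)"

definition pairing :: "'m::euclidean_space \<times> 'm covector \<Rightarrow> 'm \<times> 'm covector \<Rightarrow> real" where
  "pairing e f = blinfun_apply (snd f) (fst e) + blinfun_apply (snd e) (fst f)"

definition pairing_perp ::
  "('m::euclidean_space \<Rightarrow> ('m \<times> 'm covector) set) \<Rightarrow> 'm \<Rightarrow> ('m \<times> 'm covector) set" where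
  "pairing_perp L = (\<lambda>p. {e. \<forall>f\<in>L p. pairing e f = 0})"

definition courant_bracket ::
  "('m::euclidean_space \<Rightarrow> 'm \<times> 'm covector) \<Rightarrow> ('m \<Rightarrow> 'm \<times> 'm covector) \<Rightarrow> 'm \<Rightarrow> 'm \<times> 'm covector" where
  "courant_bracket s t =
     (let X = (\<lambda>p. fst (s p)); \<alpha> = (\<lambda>p. snd (s p)); Y = (\<lambda>p. fst (t p)); \<beta> = (\<lambda>p. snd (t p))
      in (\<lambda>p. (lie_bracket X Y p,
               lie_form X \<beta> p - lie_form Y \<alpha> p
               + (1/2) *\<^sub>R d_fun (\<lambda>q. blinfun_apply (\<alpha> q) (Y q) - blinfun_apply (\<beta> q) (X q)) p)))"

definition almost_dirac_structure :: "('m::euclidean_space \<Rightarrow> ('m \<times> 'm covector) set) \<Rightarrow> bool" where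
  "almost_dirac_structure L \<longleftrightarrow> smooth_subbundle L \<and> L = pairing_perp L"

definition dirac_structure :: "('m::euclidean_space \<Rightarrow> ('m \<times> 'm covector) set) \<Rightarrow> bool" where
  "dirac_structure L \<longleftrightarrow> almost_dirac_structure L \<and>
     (\<forall>s t. is_section L s \<longrightarrow> is_section L t \<longrightarrow> is_section L (courant_bracket s t))"

definition hamiltonian_wrt ::
  "('m::euclidean_space \<Rightarrow> ('m \<times> 'm covector) set) \<Rightarrow> ('m \<Rightarrow> 'm) \<Rightarrow> bool" where
  "hamiltonian_wrt L X \<longleftrightarrow> (\<exists>K. smooth K \<and> is_section L (\<lambda>p. (X p, d_fun K p)))"

text \<open>Points of \<open>T\<real>\<^sup>n\<close> are pairs \<open>(x, y)\<close>, and \<open>(u, w)\<close> stands for the tangent vector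
  \<open>\<Sum>\<^sub>i u\<^sub>i \<partial>/\<partial>x\<^sub>i + \<Sum>\<^sub>a w\<^sub>a \<partial>/\<partial>y\<^sub>a\<close>. Semi-sprays are
  represented by their coefficients \<open>G\<close>, which they determine uniquely.\<close>

definition semispray_field ::
  "((real^'n) \<times> (real^'n) \<Rightarrow> real^'n) \<Rightarrow> (real^'n) \<times> (real^'n) \<Rightarrow> (real^'n) \<times> (real^'n)" where
  "semispray_field G = (\<lambda>(x, y). (y, - 2 *\<^sub>R G (x, y)))"

definition is_spray :: "((real^'n) \<times> (real^'n) \<Rightarrow> real^'n) \<Rightarrow> bool" where
  "is_spray G \<longleftrightarrow> smooth G \<and> (\<forall>x y l. l > 0 \<longrightarrow> G (x, l *\<^sub>R y) = l\<^sup>2 *\<^sub>R G (x, y))"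

definition delta_x ::
  "((real^'n) \<times> (real^'n) \<Rightarrow> real^'n) \<Rightarrow> 'n \<Rightarrow> (real^'n) \<times> (real^'n) \<Rightarrow> (real^'n) \<times> (real^'n)" where
  "delta_x G i p = (axis i 1,
     - (\<Sum>a\<in>UNIV. frechet_derivative (\<lambda>q. G q $ a) (at p) (0, axis i 1) *\<^sub>R axis a 1))"

definition horizontal ::
  "((real^'n) \<times> (real^'n) \<Rightarrow> real^'n) \<Rightarrow> (real^'n) \<times> (real^'n) \<Rightarrow> ((real^'n) \<times> (real^'n)) set" where
  "horizontal G = (\<lambda>p. span (range (\<lambda>i. delta_x G i p)))"

definition R_flat :: "((real^'n) \<times> (real^'n) \<Rightarrow> real^'n) \<Rightarrow> bool" where
  "R_flat G \<longleftrightarrow> integrable_distribution (horizontal G)"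

definition constant_of_motion :: "('m::euclidean_space \<Rightarrow> 'm) \<Rightarrow> ('m \<Rightarrow> real) \<Rightarrow> bool" where
  "constant_of_motion S H \<longleftrightarrow> (\<forall>p. lie_fun S H p = 0)"

end

theory Submission
  imports Defs
begin

text \<open>Euler's relation for the 2-homogeneous \<open>G\<close> makes \<open>S\<close> a horizontal field, so
  \<open>dH(S) = \<alpha>(S) = \<omega>(S, S) = 0\<close>. For the second part, symmetry of the second derivatives of
  the parametrized integral manifolds shows that the curvature of the connection
  \<open>N\<^sup>a\<^sub>i = \<partial>G\<^sup>a/\<partial>y\<^sub>i\<close> vanishes, hence the horizontal distribution is involutive.
  Involutivity together with \<open>d\<omega> = 0\<close> gives closure of the sections of \<open>L\<close> under the
  Courant bracket, and a potential of \<open>\<alpha>\<close> from the Poincare lemma is a Hamiltonian for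
  \<open>S\<close>.\<close>

subsection \<open>Calculus of smooth maps\<close>

text \<open>After the calculus, the geometry is done for a connection \<open>N\<close> on a product
  space, whose horizontal spaces are the graphs of \<open>- N p\<close>. A vector \<open>z\<close>
  is horizontal iff \<open>snd z = - N p (fst z)\<close>, and this equation can be differentiated:
  along an integral manifold it yields zero curvature, along horizontal fields it yields
  involutivity. Graphs also supply global frames, and they extend a horizontal vector to a
  horizontal field by freezing \<open>fst z\<close>. The obstacle in the bracket computation is that
  \<beta>(Z) = \<omega>(Y, Z) holds only for Z in the distribution, whereas the bracket contains
  derivatives of fields, whose values need not lie in it. The remedy is to group such derivatives
  into Lie brackets of sections, which do lie in it. Smoothness is defined by iterated derivatives
  along constant directions. Closure under linear and bilinear maps therefore carries most
  smoothness arguments, and a derivative along a variable field is expanded in a basis.\<close>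

lemma has_derivative_frechet_derivative:
  "f differentiable (at x) \<Longrightarrow> (f has_derivative frechet_derivative f (at x)) (at x)"
  by (simp add: frechet_derivative_works)

lemma Ck_on_SucD:
  assumes "Ck_on (Suc k) U f"
  shows "Ck_on k U f"
  using assms
proof (induction k arbitrary: f)
  case 0
  then show ?case
    by (auto intro!: continuous_at_imp_continuous_on differentiable_imp_continuous_within)
next
  case (Suc k)
  then show ?case
    by (metis Ck_on.simps(2))
qed

text \<open>Openness of \<open>U\<close> makes the derivative at a point of \<open>U\<close> depend
  only on values inside \<open>U\<close>, so agreement of the maps passes to their
  derivatives.\<close>

lemma Ck_on_cong:
  assumes "open U" and "Ck_on k U f" and "\<And>x. x \<in> U \<Longrightarrow> f x = g x"
  shows "Ck_on k U g"
  using assms(2,3)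
proof (induction k arbitrary: f g)
  case 0
  then show ?case
    using continuous_on_cong by (metis Ck_on.simps(1))
next
  case (Suc k)
  have *: "(g has_derivative frechet_derivative f (at x)) (at x)" if "x \<in> U" for x
    using has_derivative_transform_within_open[OF has_derivative_frechet_derivative \<open>open U\<close> that]
      Suc.prems that by auto
  show ?case
    unfolding Ck_on.simps
  proof (intro conjI ballI allI)
    fix x assume "x \<in> U"
    then show "g differentiable (at x)"
      using * differentiable_def by blast
  next
    fix v
    show "Ck_on k U (\<lambda>x. frechet_derivative g (at x) v)"
    proof (rule Suc.IH)
      show "Ck_on k U (\<lambda>x. frechet_derivative f (at x) v)"
        using Suc.prems by simp
      show "frechet_derivative f (at x) v = frechet_derivative g (at x) v" if "x \<in> U" for x
        by (simp flip: frechet_derivative_at[OF *[OF that]])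
    qed
  qed
qed

lemma Ck_on_SucI:
  assumes "open U" and "\<And>x. x \<in> U \<Longrightarrow> (f has_derivative f' x) (at x)"
    and "\<And>v. Ck_on k U (\<lambda>x. f' x v)"
  shows "Ck_on (Suc k) U f"
  unfolding Ck_on.simps
proof (intro conjI ballI allI)
  fix x assume "x \<in> U"
  then show "f differentiable (at x)"
    using assms(2) differentiable_def by blast
next
  fix v
  show "Ck_on k U (\<lambda>x. frechet_derivative f (at x) v)"
    by (rule Ck_on_cong[OF assms(1) assms(3)[of v]]) (simp flip: frechet_derivative_at[OF assms(2)])
qed

lemma Ck_on_const: "Ck_on k U (\<lambda>x. c)"
  by (induction k arbitrary: c) auto

lemma Ck_on_id: "open U \<Longrightarrow> Ck_on k U (\<lambda>x. x)"
  by (cases k) (auto intro!: Ck_on_SucI[where f' = "\<lambda>x v. v"] Ck_on_const simp del: Ck_on.simps(2))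

lemma Ck_on_bounded_linear:
  assumes "bounded_linear T" and "open U" and "Ck_on k U f"
  shows "Ck_on k U (\<lambda>x. T (f x))"
  using assms(3)
proof (induction k arbitrary: f)
  case 0
  then show ?case
    by (simp add: bounded_linear.continuous_on[OF assms(1)])
next
  case (Suc k)
  show ?case
  proof (rule Ck_on_SucI[OF assms(2)])
    show "((\<lambda>x. T (f x)) has_derivative (\<lambda>v. T (frechet_derivative f (at x) v))) (at x)"
      if "x \<in> U" for x
      using Suc.prems that
      by (auto intro!: bounded_linear.has_derivative[OF assms(1)] has_derivative_frechet_derivative)
  qed (use Suc in auto)
qed

lemma Ck_on_add:
  assumes "open U" and "Ck_on k U f" and "Ck_on k U g"
  shows "Ck_on k U (\<lambda>x. f x + g x)"
  using assms(2,3)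
proof (induction k arbitrary: f g)
  case 0
  then show ?case
    by (simp add: continuous_on_add)
next
  case (Suc k)
  show ?case
  proof (rule Ck_on_SucI[OF assms(1)])
    show "((\<lambda>x. f x + g x) has_derivative
        (\<lambda>v. frechet_derivative f (at x) v + frechet_derivative g (at x) v)) (at x)"
      if "x \<in> U" for x
      using Suc.prems that by (auto intro!: has_derivative_add has_derivative_frechet_derivative)
  qed (use Suc in auto)
qed

lemma Ck_on_sum:
  assumes "open U" and "\<And>i. i \<in> I \<Longrightarrow> Ck_on k U (f i)"
  shows "Ck_on k U (\<lambda>x. \<Sum>i\<in>I. f i x)"
  using assms(2)
  by (induction I rule: infinite_finite_induct) (simp_all add: Ck_on_const Ck_on_add[OF assms(1)])

text \<open>The product rule leaves one factor undifferentiated in each term, so the induction also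
  needs \<open>f\<close> and \<open>g\<close> one class lower. Scalar products, inner products,
  evaluation and composition of operators are all instances.\<close>

lemma Ck_on_bilinear:
  assumes "bounded_bilinear B" and "open U" and "Ck_on k U f" and "Ck_on k U g"
  shows "Ck_on k U (\<lambda>x. B (f x) (g x))"
  using assms(3,4)
proof (induction k arbitrary: f g)
  case 0
  then show ?case
    by (simp add: bounded_bilinear.continuous_on[OF assms(1)])
next
  case (Suc k)
  note low = Suc.prems[THEN Ck_on_SucD]
  show ?case
  proof (rule Ck_on_SucI[OF assms(2)])
    show "((\<lambda>x. B (f x) (g x)) has_derivative
        (\<lambda>v. B (f x) (frechet_derivative g (at x) v) + B (frechet_derivative f (at x) v) (g x))) (at x)"
      if "x \<in> U" for x
      using Suc.prems that
      by (auto intro!: bounded_bilinear.FDERIV[OF assms(1)] has_derivative_frechet_derivative)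
  qed (use Suc low in \<open>auto intro!: Ck_on_add[OF assms(2)]\<close>)
qed

lemma smooth_on_differentiable: "smooth_on U f \<Longrightarrow> x \<in> U \<Longrightarrow> f differentiable (at x)"
  unfolding smooth_on_def by (metis Ck_on.simps(2))

lemma smooth_on_has_derivative:
  "smooth_on U f \<Longrightarrow> x \<in> U \<Longrightarrow> (f has_derivative frechet_derivative f (at x)) (at x)"
  by (simp add: smooth_on_differentiable has_derivative_frechet_derivative)

lemma smooth_on_continuous_on: "smooth_on U f \<Longrightarrow> continuous_on U f"
  unfolding smooth_on_def by (metis Ck_on.simps(1))

lemma smooth_on_frechet_derivative:
  "smooth_on U f \<Longrightarrow> smooth_on U (\<lambda>x. frechet_derivative f (at x) v)"
  unfolding smooth_on_def by (metis Ck_on.simps(2))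

lemma smooth_onI:
  assumes "open U" and "\<And>x. x \<in> U \<Longrightarrow> (f has_derivative f' x) (at x)"
    and "\<And>v. smooth_on U (\<lambda>x. f' x v)"
  shows "smooth_on U f"
  using assms Ck_on_SucI Ck_on_SucD unfolding smooth_on_def by metis

lemma smooth_on_const: "smooth_on U (\<lambda>x. c)"
  by (simp add: smooth_on_def Ck_on_const)

lemma smooth_on_id: "open U \<Longrightarrow> smooth_on U (\<lambda>x. x)"
  by (simp add: smooth_on_def Ck_on_id)

lemma smooth_on_bounded_linear:
  "bounded_linear T \<Longrightarrow> open U \<Longrightarrow> smooth_on U f \<Longrightarrow> smooth_on U (\<lambda>x. T (f x))"
  by (simp add: smooth_on_def Ck_on_bounded_linear)

lemma smooth_on_bilinear:
  "bounded_bilinear B \<Longrightarrow> open U \<Longrightarrow> smooth_on U f \<Longrightarrow> smooth_on U g \<Longrightarrow>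
    smooth_on U (\<lambda>x. B (f x) (g x))"
  by (simp add: smooth_on_def Ck_on_bilinear)

lemma smooth_on_add:
  "open U \<Longrightarrow> smooth_on U f \<Longrightarrow> smooth_on U g \<Longrightarrow> smooth_on U (\<lambda>x. f x + g x)"
  by (simp add: smooth_on_def Ck_on_add)

lemma smooth_on_sum:
  "open U \<Longrightarrow> (\<And>i. i \<in> I \<Longrightarrow> smooth_on U (f i)) \<Longrightarrow> smooth_on U (\<lambda>x. \<Sum>i\<in>I. f i x)"
  by (simp add: smooth_on_def Ck_on_sum)

lemma smooth_on_minus: "open U \<Longrightarrow> smooth_on U f \<Longrightarrow> smooth_on U (\<lambda>x. - f x)"
  by (rule smooth_on_bounded_linear[OF bounded_linear_minus[OF bounded_linear_ident]])

lemma smooth_on_diff: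
  "open U \<Longrightarrow> smooth_on U f \<Longrightarrow> smooth_on U g \<Longrightarrow> smooth_on U (\<lambda>x. f x - g x)"
  using smooth_on_add[OF _ _ smooth_on_minus, of U f g] by simp

lemma smooth_on_Pair:
  assumes "open U" and "smooth_on U f" and "smooth_on U g"
  shows "smooth_on U (\<lambda>x. (f x, g x))"
proof -
  have "smooth_on U (\<lambda>x. (f x, 0) + (0, g x))"
    using assms
    by (intro smooth_on_add smooth_on_bounded_linear[where T = "\<lambda>y. (y, 0)"]
        smooth_on_bounded_linear[where T = "\<lambda>y. (0, y)"] bounded_linear_Pair
        bounded_linear_ident bounded_linear_zero)
  then show ?thesis
    by simp
qed

lemmas smooth_on_fst = smooth_on_bounded_linear[OF bounded_linear_fst]
  and smooth_on_snd = smooth_on_bounded_linear[OF bounded_linear_snd]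
  and smooth_on_scaleR = smooth_on_bilinear[OF bounded_bilinear_scaleR]
  and smooth_on_inner = smooth_on_bilinear[OF bounded_bilinear_inner]
  and smooth_on_blinfun_apply = smooth_on_bilinear[OF bounded_bilinear_blinfun_apply]

lemmas smooth_intros = smooth_on_const smooth_on_id smooth_on_add smooth_on_diff smooth_on_minus
  smooth_on_sum smooth_on_Pair smooth_on_fst smooth_on_snd smooth_on_scaleR smooth_on_inner
  smooth_on_blinfun_apply smooth_on_frechet_derivative

section \<open>Maps into spaces of linear operators\<close>

lemma blinfun_eq_sum_Basis:
  fixes T :: "'c::euclidean_space \<Rightarrow>\<^sub>L 'b::real_normed_vector"
  shows "T = (\<Sum>b\<in>Basis. blinfun_scaleR_left (T b) o\<^sub>L blinfun_inner_left b)"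
proof (rule blinfun_eqI)
  fix v
  have "T v = T (\<Sum>b\<in>Basis. (v \<bullet> b) *\<^sub>R b)"
    by (simp add: euclidean_representation)
  then show "T v = (\<Sum>b\<in>Basis. blinfun_scaleR_left (T b) o\<^sub>L blinfun_inner_left b) v"
    by (simp add: blinfun.bilinear_simps)
qed

text \<open>On a finite-dimensional domain an operator is a finite sum of bounded linear images of
  its values on \<open>Basis\<close>, so smoothness can be tested one vector at a time.\<close>

lemma smooth_on_blinfunI:
  fixes f :: "'a::euclidean_space \<Rightarrow> 'c::euclidean_space \<Rightarrow>\<^sub>L 'b::real_normed_vector"
  assumes "open U" and "\<And>b. smooth_on U (\<lambda>x. f x b)"
  shows "smooth_on U f"
proof -
  have T: "bounded_linear (\<lambda>y::'b. blinfun_scaleR_left y o\<^sub>L blinfun_inner_left b)" for b :: 'c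
    by (intro bounded_linear_intros)
  have "smooth_on U (\<lambda>x. \<Sum>b\<in>Basis. blinfun_scaleR_left (f x b) o\<^sub>L blinfun_inner_left b)"
    by (intro smooth_on_sum smooth_on_bounded_linear[OF T] assms)
  then show ?thesis
    by (simp flip: blinfun_eq_sum_Basis)
qed

lemma linear_eq_sum_Basis:
  fixes T :: "'a::euclidean_space \<Rightarrow> 'b::real_normed_vector"
  assumes "linear T"
  shows "T v = (\<Sum>b\<in>Basis. (v \<bullet> b) *\<^sub>R T b)"
proof -
  have "T v = T (\<Sum>b\<in>Basis. (v \<bullet> b) *\<^sub>R b)"
    by (simp add: euclidean_representation)
  then show ?thesis
    by (simp add: linear_sum[OF assms] linear_cmul[OF assms])
qed

lemma smooth_frechet_derivative_field:
  assumes "smooth f" and "smooth X"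
  shows "smooth (\<lambda>p. frechet_derivative f (at p) (X p))"
proof -
  have "frechet_derivative f (at p) (X p) = (\<Sum>b\<in>Basis. (X p \<bullet> b) *\<^sub>R frechet_derivative f (at p) b)"
    for p
    using assms(1) by (intro linear_eq_sum_Basis linear_frechet_derivative smooth_on_differentiable) auto
  then show ?thesis
    using assms by (auto intro!: smooth_intros)
qed

lemma blinfun_apply_Blinfun_frechet_derivative:
  assumes "f differentiable (at p)"
  shows "blinfun_apply (Blinfun (frechet_derivative f (at p))) = frechet_derivative f (at p)"
  using assms by (intro bounded_linear_Blinfun_apply)
    (auto dest: has_derivative_frechet_derivative intro: has_derivative_bounded_linear)

lemma smooth_Blinfun_frechet_derivative:
  assumes "smooth f"
  shows "smooth (\<lambda>p. Blinfun (frechet_derivative f (at p)))"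
proof (rule smooth_on_blinfunI)
  show "smooth (\<lambda>p. Blinfun (frechet_derivative f (at p)) b)" for b
    using assms smooth_on_frechet_derivative[OF assms, of b]
    by (simp add: blinfun_apply_Blinfun_frechet_derivative smooth_on_differentiable)
qed simp

subsection \<open>Symmetry of second derivatives\<close>

text \<open>The second difference over a parallelogram is a first difference of \<open>g\<close>,
  itself a difference in direction \<open>b\<close>. The mean value theorem is applied to
  \<open>g\<close>, then to the derivative along \<open>a\<close> as a function of the
  \<open>b\<close> coordinate.\<close>

lemma mixed_difference_mean_value:
  fixes f :: "'a::real_normed_vector \<Rightarrow> real"
  assumes "s > 0"
    and V: "\<And>x y. 0 \<le> x \<Longrightarrow> x \<le> s \<Longrightarrow> 0 \<le> y \<Longrightarrow> y \<le> s \<Longrightarrow> p + x *\<^sub>R a + y *\<^sub>R b \<in> V"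
    and f': "\<And>x. x \<in> V \<Longrightarrow> (f has_derivative f' x) (at x)"
    and f'': "\<And>x v. x \<in> V \<Longrightarrow> ((\<lambda>y. f' y v) has_derivative f'' x v) (at x)"
  obtains \<xi> \<eta> where "0 \<le> \<xi>" "\<xi> \<le> s" "0 \<le> \<eta>" "\<eta> \<le> s"
    "f (p + s *\<^sub>R a + s *\<^sub>R b) - f (p + s *\<^sub>R a) - f (p + s *\<^sub>R b) + f p
      = s * s * f'' (p + \<xi> *\<^sub>R a + \<eta> *\<^sub>R b) a b"
proof -
  define g where "g x = f (p + x *\<^sub>R a + s *\<^sub>R b) - f (p + x *\<^sub>R a + 0 *\<^sub>R b)" for x
  define g' where "g' x h = f' (p + x *\<^sub>R a + s *\<^sub>R b) (h *\<^sub>R a) - f' (p + x *\<^sub>R a + 0 *\<^sub>R b) (h *\<^sub>R a)" for x h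
  have lin: "f' x (h *\<^sub>R v) = h * f' x v" if "x \<in> V" for x h v
    using linear_cmul[OF has_derivative_linear[OF f'[OF that]]] by simp
  have lin2: "f'' x u (h *\<^sub>R v) = h * f'' x u v" if "x \<in> V" for x h u v
    using linear_cmul[OF has_derivative_linear[OF f''[OF that]]] by simp
  have "(g has_derivative g' x) (at x within {0..s})" if "0 \<le> x" "x \<le> s" for x
  proof -
    have D: "((\<lambda>x. f (p + x *\<^sub>R a + y *\<^sub>R b)) has_derivative
        (\<lambda>h. f' (p + x *\<^sub>R a + y *\<^sub>R b) (h *\<^sub>R a))) (at x within {0..s})"
      if "0 \<le> y" "y \<le> s" for y
      by (rule has_derivative_compose[OF _ f'])
        (use V that \<open>0 \<le> x\<close> \<open>x \<le> s\<close> in \<open>auto intro!: derivative_eq_intros\<close>)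
    show ?thesis
      unfolding g_def g'_def
      by (intro has_derivative_diff D) (use \<open>s > 0\<close> in auto)
  qed
  then obtain \<xi> where \<xi>: "\<xi> \<in> {0..s}" "g s - g 0 = g' \<xi> (s - 0)"
    using mvt_very_simple[of 0 s g g'] \<open>s > 0\<close> by auto
  define k where "k y = f' (p + \<xi> *\<^sub>R a + y *\<^sub>R b) a" for y
  define k' where "k' y h = f'' (p + \<xi> *\<^sub>R a + y *\<^sub>R b) a (h *\<^sub>R b)" for y h
  have "(k has_derivative k' y) (at y within {0..s})" if "0 \<le> y" "y \<le> s" for y
    unfolding k_def k'_def
    by (rule has_derivative_compose[OF _ f''])
      (use V that \<xi> in \<open>auto intro!: derivative_eq_intros\<close>)
  then obtain \<eta> where \<eta>: "\<eta> \<in> {0..s}" "k s - k 0 = k' \<eta> (s - 0)"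
    using mvt_very_simple[of 0 s k k'] \<open>s > 0\<close> by auto
  have in_V: "p + \<xi> *\<^sub>R a + y *\<^sub>R b \<in> V" if "0 \<le> y" "y \<le> s" for y
    using that \<xi> by (intro V) auto
  have "g' \<xi> s = s * (k s - k 0)"
    unfolding g'_def k_def using in_V[of s] in_V[of 0] \<open>s > 0\<close>
    by (simp add: lin algebra_simps)
  also have "k s - k 0 = s * f'' (p + \<xi> *\<^sub>R a + \<eta> *\<^sub>R b) a b"
    using \<eta> in_V[of \<eta>] by (simp add: k'_def lin2)
  finally have "g s - g 0 = s * s * f'' (p + \<xi> *\<^sub>R a + \<eta> *\<^sub>R b) a b"
    using \<xi> by simp
  then show thesis
    using \<xi> \<eta> by (intro that[of \<xi> \<eta>]) (auto simp: g_def algebra_simps)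
qed

text \<open>The second difference does not change when \<open>a\<close> and \<open>b\<close> are
  swapped, so the two mixed derivatives agree at two points of a small parallelogram. Continuity at
  \<open>p\<close> then excludes different values there.\<close>

lemma second_derivative_symmetric_real:
  fixes f :: "'a::real_normed_vector \<Rightarrow> real"
  assumes "open V" and "p \<in> V"
    and f': "\<And>x. x \<in> V \<Longrightarrow> (f has_derivative f' x) (at x)"
    and f'': "\<And>x v. x \<in> V \<Longrightarrow> ((\<lambda>y. f' y v) has_derivative f'' x v) (at x)"
    and cont: "\<And>u v. continuous_on V (\<lambda>x. f'' x u v)"
  shows "f'' p a b = f'' p b a"
proof (rule ccontr)
  assume ne: "f'' p a b \<noteq> f'' p b a"
  \<comment> \<open>Half the gap: numbers strictly within \<open>e\<close> of the two values cannot
    coincide.\<close>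
  define e where "e = \<bar>f'' p a b - f'' p b a\<bar> / 2"
  have "e > 0"
    using ne by (simp add: e_def)
  have near: "\<exists>d>0. \<forall>x. dist x p < d \<longrightarrow> x \<in> V \<and> \<bar>f'' x u v - f'' p u v\<bar> < e" for u v
  proof -
    obtain d1 where d1: "d1 > 0" "ball p d1 \<subseteq> V"
      using assms(1,2) open_contains_ball by blast
    obtain d2 where d2: "d2 > 0" "\<And>x. x \<in> V \<Longrightarrow> dist x p < d2 \<Longrightarrow> dist (f'' x u v) (f'' p u v) < e"
      using cont[of u v] \<open>e > 0\<close> \<open>p \<in> V\<close> unfolding continuous_on_iff by blast
    show ?thesis
      using d1 d2 by (intro exI[of _ "min d1 d2"]) (auto simp: dist_real_def dist_commute subset_iff)
  qed
  obtain d1 where d1: "d1 > 0" "\<And>x. dist x p < d1 \<Longrightarrow> x \<in> V \<and> \<bar>f'' x a b - f'' p a b\<bar> < e"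
    using near by blast
  obtain d2 where d2: "d2 > 0" "\<And>x. dist x p < d2 \<Longrightarrow> x \<in> V \<and> \<bar>f'' x b a - f'' p b a\<bar> < e"
    using near by blast
  define d where "d = min d1 d2"
  \<comment> \<open>The summand 1 keeps the denominator positive and makes the distance estimate
    strict, even for \<open>a = b = 0\<close>.\<close>
  define s where "s = d / (norm a + norm b + 1)"
  have "d > 0" "s > 0"
    using d1 d2 by (simp_all add: d_def s_def add_nonneg_pos)
  have close: "dist (p + x *\<^sub>R a + y *\<^sub>R b) p < d"
    if "0 \<le> x" "x \<le> s" "0 \<le> y" "y \<le> s" for x y
  proof -
    have "dist (p + x *\<^sub>R a + y *\<^sub>R b) p = norm (x *\<^sub>R a + y *\<^sub>R b)"
      by (simp add: dist_norm algebra_simps)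
    also have "\<dots> \<le> x * norm a + y * norm b"
      using that by (intro order_trans[OF norm_triangle_ineq]) simp
    also have "\<dots> \<le> s * norm a + s * norm b"
      using that by (intro add_mono mult_right_mono) auto
    also have "\<dots> < s * (norm a + norm b + 1)"
      using \<open>s > 0\<close> by (simp add: algebra_simps)
    also have "\<dots> = d"
      using add_nonneg_pos[of "norm a + norm b" 1] by (simp add: s_def)
    finally show ?thesis .
  qed
  have close': "dist (p + x *\<^sub>R b + y *\<^sub>R a) p < d"
    if "0 \<le> x" "x \<le> s" "0 \<le> y" "y \<le> s" for x y
    using close[OF that(3,4,1,2)] by (simp add: algebra_simps)
  obtain x y where xy: "0 \<le> x" "x \<le> s" "0 \<le> y" "y \<le> s"
    "f (p + s *\<^sub>R a + s *\<^sub>R b) - f (p + s *\<^sub>R a) - f (p + s *\<^sub>R b) + f p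
      = s * s * f'' (p + x *\<^sub>R a + y *\<^sub>R b) a b"
    by (rule mixed_difference_mean_value[OF \<open>s > 0\<close>, of p a b V f f' f''])
      (use close d1 f' f'' in \<open>auto simp: d_def\<close>)
  obtain x' y' where xy': "0 \<le> x'" "x' \<le> s" "0 \<le> y'" "y' \<le> s"
    "f (p + s *\<^sub>R b + s *\<^sub>R a) - f (p + s *\<^sub>R b) - f (p + s *\<^sub>R a) + f p
      = s * s * f'' (p + x' *\<^sub>R b + y' *\<^sub>R a) b a"
    by (rule mixed_difference_mean_value[OF \<open>s > 0\<close>, of p b a V f f' f''])
      (use close' d1 f' f'' in \<open>auto simp: d_def\<close>)
  have "s * s * f'' (p + x *\<^sub>R a + y *\<^sub>R b) a b = s * s * f'' (p + x' *\<^sub>R b + y' *\<^sub>R a) b a"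
    using xy(5) xy'(5) by (simp add: algebra_simps)
  then have "f'' (p + x *\<^sub>R a + y *\<^sub>R b) a b = f'' (p + x' *\<^sub>R b + y' *\<^sub>R a) b a"
    using \<open>s > 0\<close> by simp
  moreover have "\<bar>f'' (p + x *\<^sub>R a + y *\<^sub>R b) a b - f'' p a b\<bar> < e"
    using d1(2) close[OF xy(1-4)] by (simp add: d_def)
  moreover have "\<bar>f'' (p + x' *\<^sub>R b + y' *\<^sub>R a) b a - f'' p b a\<bar> < e"
    using d2(2) close'[OF xy'(1-4)] by (simp add: d_def)
  ultimately show False
    unfolding e_def by argo
qed

lemma second_derivative_symmetric:
  fixes f :: "'a::real_normed_vector \<Rightarrow> 'b::real_inner"
  assumes "open V" and "p \<in> V"
    and f': "\<And>x. x \<in> V \<Longrightarrow> (f has_derivative f' x) (at x)"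
    and f'': "\<And>x v. x \<in> V \<Longrightarrow> ((\<lambda>y. f' y v) has_derivative f'' x v) (at x)"
    and cont: "\<And>u v. continuous_on V (\<lambda>x. f'' x u v)"
  shows "f'' p a b = f'' p b a"
proof (rule vector_eq_ldot[THEN iffD1, rule_format])
  fix w
  have "f'' p a b \<bullet> w = f'' p b a \<bullet> w"
    by (rule second_derivative_symmetric_real[OF assms(1,2), where f = "\<lambda>x. f x \<bullet> w"
          and f' = "\<lambda>x v. f' x v \<bullet> w" and f'' = "\<lambda>x u v. f'' x u v \<bullet> w"])
      (auto intro!: has_derivative_inner_left f' f'' continuous_intros cont)
  then show "w \<bullet> f'' p a b = w \<bullet> f'' p b a"
    by (simp add: inner_commute)
qed

subsection \<open>The horizontal distribution of a connection\<close>

text \<open>\<open>N\<close> collects the connection coefficients; for a spray they are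
  \<open>N\<^sup>a\<^sub>i = \<partial>G\<^sup>a/\<partial>y\<^sub>i\<close>.\<close>

definition hlift ::
  "('a::euclidean_space \<times> 'b::euclidean_space \<Rightarrow> 'a \<Rightarrow>\<^sub>L 'b) \<Rightarrow> 'a \<times> 'b \<Rightarrow> 'a \<Rightarrow> 'a \<times> 'b" where
  "hlift N p u = (u, - blinfun_apply (N p) u)"

definition hdist ::
  "('a::euclidean_space \<times> 'b::euclidean_space \<Rightarrow> 'a \<Rightarrow>\<^sub>L 'b) \<Rightarrow> 'a \<times> 'b \<Rightarrow> ('a \<times> 'b) set" where
  "hdist N p = range (hlift N p)"

text \<open>For constant \<open>u\<close> and \<open>w\<close>, the bracket of the two lifted fields
  has first component 0 and vertical component equal to the difference of the two sides. In
  coordinates this is \<delta>N^a_j/\<delta>x_i = \<delta>N^a_i/\<delta>x_j.\<close>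

definition curvature_free :: "('a::euclidean_space \<times> 'b::euclidean_space \<Rightarrow> 'a \<Rightarrow>\<^sub>L 'b) \<Rightarrow> bool" where
  "curvature_free N \<longleftrightarrow> (\<forall>p u w. frechet_derivative N (at p) (hlift N p u) w
     = frechet_derivative N (at p) (hlift N p w) u)"

lemma is_section_mem: "is_section E s \<Longrightarrow> s p \<in> E p"
  by (simp add: is_section_def)

lemma is_section_smooth: "is_section E s \<Longrightarrow> smooth s"
  by (simp add: is_section_def)

lemma mem_hdist_iff: "z \<in> hdist N p \<longleftrightarrow> snd z = - N p (fst z)"
  by (cases z) (auto simp: hdist_def hlift_def)

lemma hdist_eq_hlift: "z \<in> hdist N p \<Longrightarrow> z = hlift N p (fst z)"
  by (simp add: mem_hdist_iff hlift_def prod_eq_iff)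

lemma linear_hlift: "linear (hlift N p)"
  by (rule linearI) (simp_all add: hlift_def blinfun.bilinear_simps)

lemma is_section_hlift:
  assumes "smooth N"
  shows "is_section (hdist N) (\<lambda>p. hlift N p u)"
  using assms unfolding is_section_def by (auto simp: hdist_def hlift_def intro!: smooth_intros)

text \<open>This is the easy direction of Frobenius in differential form: the graph equation for the
  tangent vectors \<open>\<phi>' x a\<close> holds on the open set \<open>V\<close>, so it may be
  differentiated in every parameter direction \<open>b\<close>.\<close>

lemma curvature_freeI_integral_manifold:
  fixes N :: "'a::euclidean_space \<times> 'b::euclidean_space \<Rightarrow> 'a \<Rightarrow>\<^sub>L 'b"
  assumes N: "smooth N"
    and int: "parametrizes_integral_manifold V \<phi> (hdist N)" and "p \<in> \<phi> ` V"
  shows "frechet_derivative N (at p) (hlift N p u) w = frechet_derivative N (at p) (hlift N p w) u"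
proof -
  have "open V" and \<phi>: "smooth_on V \<phi>"
    using int by (auto simp: parametrizes_integral_manifold_def)
  obtain v where v: "v \<in> V" "\<phi> v = p"
    using assms(3) by auto
  define \<phi>' where "\<phi>' x = frechet_derivative \<phi> (at x)" for x
  define \<phi>'' where "\<phi>'' x a = frechet_derivative (\<lambda>y. \<phi>' y a) (at x)" for x a
  have range: "range (\<phi>' x) = hdist N (\<phi> x)" if "x \<in> V" for x
    using int that by (simp add: parametrizes_integral_manifold_def \<phi>'_def)
  have D1: "(\<phi> has_derivative \<phi>' x) (at x)" if "x \<in> V" for x
    using smooth_on_has_derivative[OF \<phi> that] by (simp add: \<phi>'_def)
  have s1: "smooth_on V (\<lambda>x. \<phi>' x a)" for a
    unfolding \<phi>'_def by (rule smooth_on_frechet_derivative[OF \<phi>])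
  have D2: "((\<lambda>x. \<phi>' x a) has_derivative \<phi>'' x a) (at x)" if "x \<in> V" for x a
    using smooth_on_has_derivative[OF s1 that] by (simp add: \<phi>''_def)
  have s2: "smooth_on V (\<lambda>x. \<phi>'' x a b)" for a b
    unfolding \<phi>''_def by (rule smooth_on_frechet_derivative[OF s1])
  have sym: "\<phi>'' v a b = \<phi>'' v b a" for a b
    by (rule second_derivative_symmetric[OF \<open>open V\<close> v(1) D1 D2])
      (use s2 smooth_on_continuous_on in blast)+
  let ?N' = "frechet_derivative N (at p)"
  have N': "(N has_derivative ?N') (at (\<phi> v))"
    using smooth_on_has_derivative[OF N, of p] v by simp
  have key: "?N' (\<phi>' v b) (fst (\<phi>' v a)) = - snd (\<phi>'' v a b) - N p (fst (\<phi>'' v a b))" for a b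
  proof -
    let ?F = "\<lambda>x. snd (\<phi>' x a) + N (\<phi> x) (fst (\<phi>' x a))"
    have F: "(?F has_derivative
       (\<lambda>b. snd (\<phi>'' v a b) + (N (\<phi> v) (fst (\<phi>'' v a b)) + ?N' (\<phi>' v b) (fst (\<phi>' v a))))) (at v)"
      by (intro has_derivative_add bounded_bilinear.FDERIV[OF bounded_bilinear_blinfun_apply]
          has_derivative_snd has_derivative_fst D2 v
          has_derivative_compose[OF D1[OF v(1)] N'])
    have zero: "?F x = 0" if "x \<in> V" for x
      using range[OF that] mem_hdist_iff[of "\<phi>' x a" N "\<phi> x"] by auto
    have "(?F has_derivative (\<lambda>b. 0)) (at v)"
      by (rule has_derivative_transform_within_open[OF has_derivative_const[of 0] \<open>open V\<close> v(1)])
        (simp add: zero)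
    from fun_cong[OF has_derivative_unique[OF F this], of b] v show ?thesis
      by (simp add: eq_diff_eq add_eq_0_iff add.commute)
  qed
  \<comment> \<open>With \<open>a\<close>, \<open>b\<close> mapped to the lifts of \<open>u\<close>,
    \<open>w\<close>, the left side of \<open>key\<close> becomes the curvature term, while its
    right side depends only on \<open>\<phi>'' v a b\<close>, which is symmetric.\<close>
  have "hlift N p u \<in> range (\<phi>' v)" "hlift N p w \<in> range (\<phi>' v)"
    using range[OF v(1)] v by (auto simp: hdist_def)
  then obtain a b where "\<phi>' v a = hlift N p u" "\<phi>' v b = hlift N p w"
    by (metis imageE)
  with key[of a b] key[of b a] sym[of a b] show ?thesis
    by (simp add: hlift_def)
qed

lemma smooth_lie_bracket: "smooth X \<Longrightarrow> smooth Y \<Longrightarrow> smooth (lie_bracket X Y)"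
  unfolding lie_bracket_def by (intro smooth_on_diff smooth_frechet_derivative_field open_UNIV)

text \<open>After differentiating the graph equation of each field, the derivatives of the fields
  assemble into \<open>- N p\<close> of the first component of the bracket. The leftover is the
  curvature evaluated at \<open>fst (X p)\<close> and \<open>fst (Y p)\<close>.\<close>

lemma is_section_lie_bracket_hdist:
  assumes N: "smooth N" and flat: "curvature_free N"
    and X: "is_section (hdist N) X" and Y: "is_section (hdist N) Y"
  shows "is_section (hdist N) (lie_bracket X Y)"
  unfolding is_section_def
proof (intro conjI allI)
  show "smooth (lie_bracket X Y)"
    using X Y by (simp add: is_section_def smooth_lie_bracket)
next
  fix p
  let ?N' = "frechet_derivative N (at p)"
  have deriv: "snd (frechet_derivative Z (at p) v)
      = - N p (fst (frechet_derivative Z (at p) v)) - ?N' v (fst (Z p))"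
    if Z: "is_section (hdist N) Z" for Z v
  proof -
    let ?Z' = "frechet_derivative Z (at p)"
    have Z': "(Z has_derivative ?Z') (at p)"
      using Z by (auto simp: is_section_def intro: smooth_on_has_derivative)
    have "((\<lambda>q. - N q (fst (Z q))) has_derivative
        (\<lambda>v. - (N p (fst (?Z' v)) + ?N' v (fst (Z p))))) (at p)"
      by (intro has_derivative_minus bounded_bilinear.FDERIV[OF bounded_bilinear_blinfun_apply]
          has_derivative_fst Z' smooth_on_has_derivative[OF N]) simp
    moreover have "(\<lambda>q. - N q (fst (Z q))) = (\<lambda>q. snd (Z q))"
      using Z by (auto simp: is_section_def mem_hdist_iff simp del: split_paired_All)
    ultimately have "(\<lambda>v. snd (?Z' v)) = (\<lambda>v. - (N p (fst (?Z' v)) + ?N' v (fst (Z p))))"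
      by (intro has_derivative_unique[OF has_derivative_snd[OF Z']]) simp
    from fun_cong[OF this, of v] show ?thesis
      by simp
  qed
  have "X p = hlift N p (fst (X p))" "Y p = hlift N p (fst (Y p))"
    using X Y by (simp_all add: is_section_mem hdist_eq_hlift[symmetric])
  then have "?N' (X p) (fst (Y p)) = ?N' (Y p) (fst (X p))"
    using flat unfolding curvature_free_def by metis
  then show "lie_bracket X Y p \<in> hdist N p"
    by (simp add: mem_hdist_iff lie_bracket_def deriv[OF X] deriv[OF Y] blinfun.bilinear_simps)
qed

subsection \<open>The Dirac structure defined by a distribution and a two-form\<close>

text \<open>The distribution is left arbitrary because the bracket computation uses only
  involutivity and the extension of vectors to sections. Isotropy and the frame are treated for
  graphs.\<close>

definition dist_dirac ::
  "('m::euclidean_space \<Rightarrow> 'm set) \<Rightarrow> ('m \<Rightarrow> 'm bilin) \<Rightarrow> 'm \<Rightarrow> ('m \<times> 'm covector) set" where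
  "dist_dirac D \<omega> = (\<lambda>p. {(X, \<beta>). X \<in> D p \<and> \<beta> - \<omega> p X \<in> annihilator D p})"

lemma mem_dist_dirac_iff:
  "e \<in> dist_dirac D \<omega> p \<longleftrightarrow> fst e \<in> D p \<and> (\<forall>z\<in>D p. snd e z = \<omega> p (fst e) z)"
  by (cases e) (auto simp: dist_dirac_def annihilator_def blinfun.bilinear_simps)

lemma two_form_antisym:
  assumes "two_form \<omega>"
  shows "\<omega> p u v = - \<omega> p v u"
proof -
  have "\<omega> p (u + v) (u + v) = 0" "\<omega> p u u = 0" "\<omega> p v v = 0"
    using assms unfolding two_form_def by blast+
  then show ?thesis
    by (simp add: blinfun.bilinear_simps)
qed

section \<open>Smoothness and pointwise values of the bracket operations\<close>

lemma smooth_lie_form: "smooth X \<Longrightarrow> smooth \<beta> \<Longrightarrow> smooth (lie_form X \<beta>)"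
  unfolding lie_form_def
  by (intro smooth_on_add smooth_frechet_derivative_field smooth_Blinfun_frechet_derivative
      smooth_on_bilinear[OF bounded_bilinear_blinfun_compose] open_UNIV)

lemma smooth_d_fun: "smooth f \<Longrightarrow> smooth (d_fun f)"
  unfolding d_fun_def by (rule smooth_Blinfun_frechet_derivative)

lemma smooth_courant_bracket:
  assumes "smooth s" and "smooth t"
  shows "smooth (courant_bracket s t)"
  unfolding courant_bracket_def Let_def using assms
  by (intro smooth_on_Pair smooth_on_add smooth_on_diff smooth_on_scaleR smooth_lie_bracket
      smooth_lie_form smooth_d_fun smooth_on_const smooth_on_blinfun_apply smooth_on_fst smooth_on_snd
      open_UNIV)

lemma lie_form_apply:
  assumes "smooth X"
  shows "lie_form X \<beta> p z = frechet_derivative \<beta> (at p) (X p) z + \<beta> p (frechet_derivative X (at p) z)"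
  using assms by (simp add: lie_form_def blinfun.bilinear_simps
      blinfun_apply_Blinfun_frechet_derivative smooth_on_differentiable)

lemma d_fun_apply:
  assumes "smooth f"
  shows "d_fun f p z = frechet_derivative f (at p) z"
  using assms
  by (simp add: d_fun_def blinfun_apply_Blinfun_frechet_derivative smooth_on_differentiable)

lemma frechet_derivative_blinfun_apply:
  assumes "f differentiable (at p)" and "g differentiable (at p)"
  shows "frechet_derivative (\<lambda>q. blinfun_apply (f q) (g q)) (at p) v
    = f p (frechet_derivative g (at p) v) + frechet_derivative f (at p) v (g p)"
  by (rule fun_cong[OF frechet_derivative_at[OF bounded_bilinear.FDERIV[OF
        bounded_bilinear_blinfun_apply assms[THEN has_derivative_frechet_derivative]], symmetric]])

text \<open>On sections of \<open>dist_dirac D \<omega>\<close> the Courant bracket is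
  \<open>([X, Y], \<L>\<^sub>X\<beta> - i\<^sub>Y d\<alpha>)\<close>. Differentiating the relation
  \<open>\<beta>(Z) = \<omega>(Y, Z)\<close> against a section \<open>Z\<close> of \<open>D\<close> through the test vector
  replaces all derivatives of \<open>\<alpha>\<close> and \<open>\<beta>\<close> by derivatives of \<open>\<omega>\<close>, which add up to \<open>d\<omega>\<close>.\<close>

lemma is_section_courant_bracket:
  fixes D :: "'m::euclidean_space \<Rightarrow> 'm set"
  assumes invol: "\<And>X Y. is_section D X \<Longrightarrow> is_section D Y \<Longrightarrow> is_section D (lie_bracket X Y)"
    and ext: "\<And>p z. z \<in> D p \<Longrightarrow> \<exists>Z. is_section D Z \<and> Z p = z"
    and \<omega>: "closed_two_form \<omega>"
    and s: "is_section (dist_dirac D \<omega>) s" and t: "is_section (dist_dirac D \<omega>) t"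
  shows "is_section (dist_dirac D \<omega>) (courant_bracket s t)"
proof -
  define X Y a b where defs: "X = (\<lambda>p. fst (s p))" "Y = (\<lambda>p. fst (t p))"
    "a = (\<lambda>p. snd (s p))" "b = (\<lambda>p. snd (t p))"
  have sm: "smooth X" "smooth Y" "smooth a" "smooth b" "smooth \<omega>"
    using s t \<omega> unfolding defs closed_two_form_def two_form_def is_section_def
    by (auto intro!: smooth_intros)
  have X: "is_section D X" and Y: "is_section D Y"
    using is_section_mem[OF s] is_section_mem[OF t] sm
    by (simp_all add: is_section_def defs mem_dist_dirac_iff)
  have aD: "a q z = \<omega> q (X q) z" and bD: "b q z = \<omega> q (Y q) z" if "z \<in> D q" for q z
    using is_section_mem[OF s, of q] is_section_mem[OF t, of q] that
    by (simp_all add: defs mem_dist_dirac_iff)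
  have antisym: "\<omega> q u v = - \<omega> q v u" for q u v
    using \<omega> two_form_antisym unfolding closed_two_form_def by blast
  \<comment> \<open>Here a(Y) = \<omega>(X, Y) = - \<omega>(Y, X) = - b(X), so the last term of the
    bracket is just d(a(Y)).\<close>
  let ?f = "\<lambda>q. a q (Y q) - b q (X q)"
  have isotropic: "?f = (\<lambda>q. 2 *\<^sub>R a q (Y q))"
  proof
    fix q
    show "a q (Y q) - b q (X q) = 2 *\<^sub>R a q (Y q)"
      using aD[OF is_section_mem[OF Y], of q] bD[OF is_section_mem[OF X], of q]
        antisym[of q "X q" "Y q"] by simp
  qed
  have smooth_aY: "smooth (\<lambda>q. a q (Y q))"
    using sm by (auto intro!: smooth_intros)
  show ?thesis
    unfolding is_section_def mem_dist_dirac_iff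
  proof (intro conjI allI ballI)
    show "smooth (courant_bracket s t)"
      using s t by (simp add: is_section_def smooth_courant_bracket)
    show "fst (courant_bracket s t p) \<in> D p" for p
      using is_section_mem[OF invol[OF X Y], of p] by (simp add: courant_bracket_def Let_def defs)
    fix p z
    assume "z \<in> D p"
    then obtain Z where Z: "is_section D Z" "Z p = z"
      using ext by blast
    let ?d = "\<lambda>f. frechet_derivative f (at p)"
    note diff = sm[THEN smooth_on_differentiable, of p, OF UNIV_I]
      Z(1)[THEN is_section_smooth, THEN smooth_on_differentiable, of p, OF UNIV_I]
    \<comment> \<open>Both sides differentiate one scalar identity c(W) = \<omega>(V, W) along
      \<open>v\<close>. It has to hold at every point, which is why \<open>z\<close> was extended to
      a section \<open>Z\<close>.\<close>
    have leibniz: "?d c v (W p) + c p (?d W v)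
        = ?d \<omega> v (V p) (W p) + \<omega> p (?d V v) (W p) + \<omega> p (V p) (?d W v)"
      if "c differentiable (at p)" "V differentiable (at p)" "W differentiable (at p)"
        and eq: "\<And>q. c q (W q) = \<omega> q (V q) (W q)"
      for c :: "'m \<Rightarrow> 'm covector" and V W :: "'m \<Rightarrow> 'm" and v
    proof -
      have "(\<lambda>q. \<omega> q (V q)) differentiable (at p)"
        using bounded_bilinear.FDERIV[OF bounded_bilinear_blinfun_apply
            diff(5)[THEN has_derivative_frechet_derivative]
            that(2)[THEN has_derivative_frechet_derivative]]
        by (auto simp: differentiable_def)
      then show ?thesis
        using frechet_derivative_blinfun_apply[OF that(1,3), of v]
          frechet_derivative_blinfun_apply[OF _ that(3), of "\<lambda>q. \<omega> q (V q)" v]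
        by (simp add: eq frechet_derivative_blinfun_apply[OF diff(5) that(2)] blinfun.bilinear_simps)
    qed
    have E1: "?d b (X p) z + b p (?d Z (X p))
        = ?d \<omega> (X p) (Y p) z + \<omega> p (?d Y (X p)) z + \<omega> p (Y p) (?d Z (X p))"
      using leibniz[of b Y Z "X p"] diff bD[OF is_section_mem[OF Z(1)]] Z(2) by simp
    have E2: "?d a (Y p) z + a p (?d Z (Y p))
        = ?d \<omega> (Y p) (X p) z + \<omega> p (?d X (Y p)) z + \<omega> p (X p) (?d Z (Y p))"
      using leibniz[of a X Z "Y p"] diff aD[OF is_section_mem[OF Z(1)]] Z(2) by simp
    have E3: "?d a z (Y p) + a p (?d Y z)
        = ?d \<omega> z (X p) (Y p) + \<omega> p (?d X z) (Y p) + \<omega> p (X p) (?d Y z)"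
      using leibniz[of a X Y z] diff aD[OF is_section_mem[OF Y]] by simp
    \<comment> \<open>The derivatives of \<open>Z\<close> and \<open>X\<close> need not lie in
      \<open>D\<close> separately, but their difference is [X, Z], where \<open>b\<close> equals
      \<omega>(Y, -). This trades derivatives of the auxiliary \<open>Z\<close> for derivatives of
      \<open>X\<close>; \<open>I2\<close> does the same with \<open>Y\<close>.\<close>
    have I1: "b p (?d Z (X p)) - b p (?d X z) = \<omega> p (Y p) (?d Z (X p)) - \<omega> p (Y p) (?d X z)"
      using bD[OF is_section_mem[OF invol[OF X Z(1)]], of p] Z(2)
      by (simp add: lie_bracket_def blinfun.bilinear_simps)
    have I2: "a p (?d Z (Y p)) - a p (?d Y z) = \<omega> p (X p) (?d Z (Y p)) - \<omega> p (X p) (?d Y z)"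
      using aD[OF is_section_mem[OF invol[OF Y Z(1)]], of p] Z(2)
      by (simp add: lie_bracket_def blinfun.bilinear_simps)
    have closed: "?d \<omega> (X p) (Y p) z - ?d \<omega> (Y p) (X p) z + ?d \<omega> z (X p) (Y p) = 0"
      using \<omega> unfolding closed_two_form_def d_two_def by blast
    have "d_fun ?f p z = 2 * (a p (?d Y z) + ?d a z (Y p))"
    proof -
      have "smooth ?f"
        using sm by (auto intro!: smooth_intros)
      then have "d_fun ?f p z = frechet_derivative (\<lambda>q. 2 *\<^sub>R a q (Y q)) (at p) z"
        by (simp only: d_fun_apply isotropic)
      also have "\<dots> = 2 *\<^sub>R ?d (\<lambda>q. a q (Y q)) z"
        by (rule fun_cong[OF frechet_derivative_at[symmetric]])
          (intro has_derivative_scaleR_right smooth_on_has_derivative[OF smooth_aY] UNIV_I)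
      finally show ?thesis
        by (simp add: frechet_derivative_blinfun_apply diff)
    qed
    then have "snd (courant_bracket s t p) z = ?d b (X p) z + b p (?d X z) - ?d a (Y p) z + ?d a z (Y p)"
      using sm by (simp add: courant_bracket_def Let_def blinfun.bilinear_simps lie_form_apply
          add_divide_distrib
          flip: defs)
    \<comment> \<open>The derivatives of \<omega> sum to d\<omega>(X, Y, z) = 0, those of
      \<open>Z\<close> cancel by \<open>I1\<close> and \<open>I2\<close>, and the two terms with
      \<open>?d X z\<close> cancel by antisymmetry.\<close>
    also have "\<dots> = \<omega> p (?d Y (X p)) z - \<omega> p (?d X (Y p)) z"
      using E1 E2 E3 I1 I2 closed antisym[of p "Y p" "?d X z"] by linarith
    also have "\<dots> = \<omega> p (fst (courant_bracket s t p)) z"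
      by (simp add: courant_bracket_def Let_def lie_bracket_def blinfun.bilinear_simps flip: defs)
    finally show "snd (courant_bracket s t p) z = \<omega> p (fst (courant_bracket s t p)) z" .
  qed
qed

text \<open>For \<open>w\<close> a standard basis vector these are the one-forms dy_a + N^a_i dx_i
  (summed over i), the coframe dual to the vertical directions that annihilates horizontal
  vectors.\<close>

definition hform ::
  "('a::euclidean_space \<times> 'b::euclidean_space \<Rightarrow> 'a \<Rightarrow>\<^sub>L 'b) \<Rightarrow> 'a \<times> 'b \<Rightarrow> 'b \<Rightarrow> ('a \<times> 'b) covector" where
  "hform N p w = Blinfun (\<lambda>z. (snd z + N p (fst z)) \<bullet> w)"

lemma hform_apply: "hform N p w z = (snd z + N p (fst z)) \<bullet> w"
  unfolding hform_def
  by (subst bounded_linear_Blinfun_apply) (intro bounded_linear_intros, rule refl)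

lemma linear_hform: "linear (hform N p)"
  by (rule linearI; rule blinfun_eqI) (simp_all add: hform_apply blinfun.bilinear_simps inner_simps)

lemma hform_hdist: "z \<in> hdist N p \<Longrightarrow> hform N p w z = 0"
  by (simp add: hform_apply mem_hdist_iff)

text \<open>Each vector is a horizontal lift plus a vertical vector. The form kills the lift, so it
  is determined by its restriction to vertical vectors, and \<open>w\<close> is the Riesz
  representative of that restriction.\<close>

lemma annihilator_hdistE:
  assumes "\<theta> \<in> annihilator (hdist N) p"
  obtains w where "\<theta> = hform N p w"
proof
  define w where "w = (\<Sum>b\<in>Basis. \<theta> (0, b) *\<^sub>R b)"
  have "\<theta> z = hform N p w z" for z
  proof -
    have lin: "linear (\<lambda>x. \<theta> (0, x))"
      using blinfun.add_right[of \<theta> "(0, x)" "(0, y)" for x y]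
        blinfun.scaleR_right[of \<theta> r "(0, x)" for r x]
      by (auto intro!: linearI)
    have "\<theta> z = \<theta> (hlift N p (fst z)) + \<theta> (0, snd z + N p (fst z))"
      by (simp add: hlift_def flip: blinfun.add_right)
    also have "\<theta> (hlift N p (fst z)) = 0"
      using assms by (simp add: annihilator_def hdist_def)
    also have "\<theta> (0, x) = x \<bullet> w" for x
      using linear_eq_sum_Basis[OF lin, of x]
      by (simp add: w_def inner_sum_right mult.commute)
    finally show ?thesis
      by (simp add: hform_apply)
  qed
  then show "\<theta> = hform N p w"
    by (rule blinfun_eqI)
qed

text \<open>A linear parametrization of the fibre by the model space: \<open>fst v\<close> selects
  the horizontal vector and \<open>snd v\<close> the annihilator part of the covector. Any basis of
  the model space thus gives a global frame.\<close>

definition dirac_frame ::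
  "('a::euclidean_space \<times> 'b::euclidean_space \<Rightarrow> 'a \<Rightarrow>\<^sub>L 'b) \<Rightarrow> ('a \<times> 'b \<Rightarrow> ('a \<times> 'b) bilin) \<Rightarrow>
    'a \<times> 'b \<Rightarrow> 'a \<times> 'b \<Rightarrow> ('a \<times> 'b) \<times> ('a \<times> 'b) covector" where
  "dirac_frame N \<omega> p v = (hlift N p (fst v), \<omega> p (hlift N p (fst v)) + hform N p (snd v))"

lemma linear_dirac_frame: "linear (dirac_frame N \<omega> p)"
  by (rule linearI) (simp_all add: dirac_frame_def linear_add[OF linear_hlift]
      linear_cmul[OF linear_hlift] linear_add[OF linear_hform] linear_cmul[OF linear_hform]
      blinfun.bilinear_simps algebra_simps)

lemma inj_dirac_frame: "inj (dirac_frame N \<omega> p)"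
proof (rule linear_injective_0[OF linear_dirac_frame, THEN iffD2], intro allI impI)
  fix v
  assume "dirac_frame N \<omega> p v = 0"
  then have *: "hlift N p (fst v) = 0" "\<omega> p (hlift N p (fst v)) + hform N p (snd v) = 0"
    by (simp_all add: dirac_frame_def prod_eq_iff)
  then have "fst v = 0"
    by (simp add: hlift_def zero_prod_def)
  \<comment> \<open>Testing the covector on the vertical vector \<open>(0, snd v)\<close> returns
    the squared norm of \<open>snd v\<close>.\<close>
  moreover have "snd v \<bullet> snd v = 0"
    using hform_apply[of N p "snd v" "(0, snd v)"] * by (simp add: blinfun.bilinear_simps)
  ultimately show "v = 0"
    by (simp add: prod_eq_iff)
qed

lemma range_dirac_frame: "range (dirac_frame N \<omega> p) = dist_dirac (hdist N) \<omega> p"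
proof (intro set_eqI iffI)
  fix e
  assume "e \<in> range (dirac_frame N \<omega> p)"
  then show "e \<in> dist_dirac (hdist N) \<omega> p"
    by (auto simp: mem_dist_dirac_iff dirac_frame_def hform_hdist blinfun.bilinear_simps)
      (simp add: hdist_def)
next
  fix e
  assume e: "e \<in> dist_dirac (hdist N) \<omega> p"
  then have "snd e - \<omega> p (fst e) \<in> annihilator (hdist N) p"
    by (auto simp: dist_dirac_def)
  then obtain w where "snd e - \<omega> p (fst e) = hform N p w"
    by (rule annihilator_hdistE)
  then have "e = dirac_frame N \<omega> p (fst (fst e), w)"
    using hdist_eq_hlift[of "fst e" N p, symmetric] e
    by (simp add: dirac_frame_def prod_eq_iff[of e] mem_dist_dirac_iff algebra_simps)
  then show "e \<in> range (dirac_frame N \<omega> p)"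
    by blast
qed

lemma smooth_hlift: "smooth N \<Longrightarrow> smooth (\<lambda>p. hlift N p u)"
  using is_section_hlift is_section_smooth by blast

lemma smooth_hform: "smooth N \<Longrightarrow> smooth (\<lambda>p. hform N p w)"
  by (rule smooth_on_blinfunI) (auto simp: hform_apply intro!: smooth_intros)

lemma smooth_subbundle_dist_dirac:
  fixes N :: "'a::euclidean_space \<times> 'b::euclidean_space \<Rightarrow> 'a \<Rightarrow>\<^sub>L 'b"
  assumes "smooth N" and "smooth \<omega>"
  shows "smooth_subbundle (dist_dirac (hdist N) \<omega>)"
proof -
  let ?k = "DIM('a \<times> 'b)"
  obtain e :: "nat \<Rightarrow> 'a \<times> 'b" where e: "bij_betw e {..<?k} Basis"
    using ex_bij_betw_nat_finite[OF finite_Basis[where 'a = "'a \<times> 'b"]] by (auto simp: atLeast0LessThan)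
  let ?s = "\<lambda>i q. dirac_frame N \<omega> q (e i)"
  have img: "(\<lambda>i. ?s i q) ` {..<?k} = dirac_frame N \<omega> q ` Basis" for q
    using bij_betw_imp_surj_on[OF e] by (metis image_image)
  have "smooth (?s i)" for i
    using assms unfolding dirac_frame_def by (intro smooth_intros smooth_hlift smooth_hform open_UNIV)
  moreover have "inj_on (\<lambda>i. ?s i q) {..<?k}" for q
    using comp_inj_on[OF bij_betw_imp_inj_on[OF e] inj_on_subset[OF inj_dirac_frame subset_UNIV]]
    by (simp add: comp_def)
  moreover have "independent ((\<lambda>i. ?s i q) ` {..<?k})" for q
    unfolding img by (rule linear_independent_injective_image[OF linear_dirac_frame independent_Basis
        inj_on_subset[OF inj_dirac_frame subset_UNIV]])
  moreover have "span ((\<lambda>i. ?s i q) ` {..<?k}) = dist_dirac (hdist N) \<omega> q" for q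
    unfolding img linear_span_image[OF linear_dirac_frame] by (simp add: range_dirac_frame)
  ultimately show ?thesis
    unfolding smooth_subbundle_def
    by (intro exI[of _ ?k] allI exI[of _ UNIV] exI[of _ ?s]) simp
qed

text \<open>Isotropy is antisymmetry of \<omega>. For the converse two families of elements suffice:
  \<open>(0, hform N p w)\<close> forces \<open>fst e\<close> to be horizontal, and
  \<open>(z, \<omega> p z)\<close> then determines \<open>snd e\<close> on horizontal
  vectors.\<close>

lemma dist_dirac_eq_pairing_perp:
  fixes N :: "'a::euclidean_space \<times> 'b::euclidean_space \<Rightarrow> 'a \<Rightarrow>\<^sub>L 'b"
  assumes \<omega>: "two_form \<omega>"
  shows "dist_dirac (hdist N) \<omega> = pairing_perp (dist_dirac (hdist N) \<omega>)"
proof (intro ext set_eqI iffI)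
  fix p e
  assume e: "e \<in> dist_dirac (hdist N) \<omega> p"
  have "pairing e f = 0" if "f \<in> dist_dirac (hdist N) \<omega> p" for f
    using e that two_form_antisym[OF \<omega>, of p "fst e" "fst f"]
    by (simp add: pairing_def mem_dist_dirac_iff)
  then show "e \<in> pairing_perp (dist_dirac (hdist N) \<omega>) p"
    by (simp add: pairing_perp_def)
next
  fix p e
  assume "e \<in> pairing_perp (dist_dirac (hdist N) \<omega>) p"
  then have perp: "pairing e f = 0" if "f \<in> dist_dirac (hdist N) \<omega> p" for f
    using that by (simp add: pairing_perp_def)
  have "hform N p w (fst e) = 0" for w
    using perp[of "(0, hform N p w)"]
    by (simp add: mem_dist_dirac_iff pairing_def hform_hdist blinfun.bilinear_simps)
      (simp add: mem_hdist_iff blinfun.bilinear_simps)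
  then have "(snd (fst e) + N p (fst (fst e))) \<bullet> w = 0" for w
    by (simp add: hform_apply)
  then have "snd (fst e) + N p (fst (fst e)) = 0"
    by (rule inner_eq_zero_iff[THEN iffD1])
  then have "fst e \<in> hdist N p"
    by (simp add: mem_hdist_iff eq_neg_iff_add_eq_0)
  moreover have "snd e z = \<omega> p (fst e) z" if "z \<in> hdist N p" for z
    using perp[of "(z, \<omega> p z)"] that two_form_antisym[OF \<omega>, of p z "fst e"]
    by (simp add: mem_dist_dirac_iff pairing_def)
  ultimately show "e \<in> dist_dirac (hdist N) \<omega> p"
    by (simp add: mem_dist_dirac_iff)
qed

lemma dirac_structure_dist_dirac_hdist:
  fixes N :: "'a::euclidean_space \<times> 'b::euclidean_space \<Rightarrow> 'a \<Rightarrow>\<^sub>L 'b"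
  assumes N: "smooth N" and flat: "curvature_free N" and \<omega>: "closed_two_form \<omega>"
  shows "dirac_structure (dist_dirac (hdist N) \<omega>)"
  unfolding dirac_structure_def almost_dirac_structure_def
proof (intro conjI allI impI)
  show "smooth_subbundle (dist_dirac (hdist N) \<omega>)"
    using N \<omega> by (intro smooth_subbundle_dist_dirac) (auto simp: closed_two_form_def two_form_def)
  show "dist_dirac (hdist N) \<omega> = pairing_perp (dist_dirac (hdist N) \<omega>)"
    using \<omega> by (intro dist_dirac_eq_pairing_perp) (simp add: closed_two_form_def)
  fix s t
  assume st: "is_section (dist_dirac (hdist N) \<omega>) s" "is_section (dist_dirac (hdist N) \<omega>) t"
  have "\<exists>Z. is_section (hdist N) Z \<and> Z p = z" if "z \<in> hdist N p" for p z
    using is_section_hlift[OF N, of "fst z"] hdist_eq_hlift[OF that] by metis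
  then show "is_section (dist_dirac (hdist N) \<omega>) (courant_bracket s t)"
    by (intro is_section_courant_bracket is_section_lie_bracket_hdist N flat \<omega> st)
qed

subsection \<open>The Poincare lemma for one-forms\<close>

text \<open>The whole space is star-shaped about 0, so the potential is the line integral of
  \<alpha> along the segment from 0 to \<open>p\<close>.\<close>

lemma closed_one_form_exact:
  fixes \<alpha> :: "'m::euclidean_space \<Rightarrow> 'm covector"
  assumes "closed_one_form \<alpha>"
  obtains K where "smooth K" and "d_fun K = \<alpha>"
proof -
  have \<alpha>: "smooth \<alpha>" and closed: "frechet_derivative \<alpha> (at p) u v = frechet_derivative \<alpha> (at p) v u" for p u v
    using assms by (auto simp: closed_one_form_def one_form_def d_one_def)
  define K where "K p = integral (cbox 0 1) (\<lambda>t::real. \<alpha> (t *\<^sub>R p) p)" for p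
  let ?D = "\<lambda>q. frechet_derivative \<alpha> (at q)"
  \<comment> \<open>\<open>A p t\<close> is the t-derivative of
    \<open>t *\<^sub>R \<alpha> (t *\<^sub>R p)\<close>, and by closedness also the derivative in
    \<open>p\<close> of the integrand of \<open>K\<close>. Integrating over [0, 1] therefore leaves
    \<alpha>(p).\<close>
  define A where "A p t = t *\<^sub>R ?D (t *\<^sub>R p) p + \<alpha> (t *\<^sub>R p)" for p and t :: real
  have lin: "linear (?D q)" for q
    using \<alpha> by (intro linear_frechet_derivative smooth_on_differentiable) auto
  have D: "(\<alpha> has_derivative ?D q) (at q within S)" for q S
    using smooth_on_has_derivative[OF \<alpha>] has_derivative_at_withinI by blast
  have cont_\<alpha>: "continuous_on S \<alpha>" for S
    using smooth_on_continuous_on[OF \<alpha>] continuous_on_subset by blast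
  have cont_D: "continuous_on S (\<lambda>q. ?D q b)" for S b
    using smooth_on_continuous_on[OF smooth_on_frechet_derivative[OF \<alpha>]] continuous_on_subset by blast
  \<comment> \<open>The derivative of \<alpha> is known to be continuous for fixed directions only;
    expanding the direction in \<open>Basis\<close> gives the joint continuity required under the
    integral.\<close>
  have cont_A: "continuous_on S (\<lambda>(p, t). A p t)" for S
  proof -
    have "(\<lambda>(p, t). A p t)
        = (\<lambda>z. snd z *\<^sub>R (\<Sum>b\<in>Basis. (fst z \<bullet> b) *\<^sub>R ?D (snd z *\<^sub>R fst z) b) + \<alpha> (snd z *\<^sub>R fst z))"
      by (auto simp: A_def fun_eq_iff simp flip: linear_eq_sum_Basis[OF lin])
    then show ?thesis
      by (simp only:) (intro continuous_intros continuous_on_compose2[OF cont_D[of UNIV]]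
          continuous_on_compose2[OF cont_\<alpha>[of UNIV]] subset_UNIV)
  qed
  have K': "(K has_derivative blinfun_apply (\<alpha> p)) (at p)" for p
  proof -
    have "(K has_derivative blinfun_apply (integral (cbox 0 1) (A p))) (at p within UNIV)"
      unfolding K_def
    proof (rule leibniz_rule)
      show "((\<lambda>x. \<alpha> (t *\<^sub>R x) x) has_derivative blinfun_apply (A x t)) (at x within UNIV)" for x t
      proof -
        have "((\<lambda>x. \<alpha> (t *\<^sub>R x)) has_derivative (\<lambda>v. ?D (t *\<^sub>R x) (t *\<^sub>R v))) (at x)"
          by (rule has_derivative_compose[OF _ D]) (auto intro!: derivative_eq_intros)
        from bounded_bilinear.FDERIV[OF bounded_bilinear_blinfun_apply this has_derivative_ident]
        have "((\<lambda>x. \<alpha> (t *\<^sub>R x) x) has_derivative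
            (\<lambda>v. \<alpha> (t *\<^sub>R x) v + ?D (t *\<^sub>R x) (t *\<^sub>R v) x)) (at x)" .
        moreover have "?D (t *\<^sub>R x) (t *\<^sub>R v) x = t * ?D (t *\<^sub>R x) x v" for v
          using closed[of "t *\<^sub>R x" v x] by (simp add: linear_cmul[OF lin] blinfun.bilinear_simps)
        ultimately show ?thesis
          by (auto simp: A_def blinfun.bilinear_simps add.commute elim!: has_derivative_eq_rhs)
      qed
      show "(\<lambda>t. \<alpha> (t *\<^sub>R x) x) integrable_on cbox 0 1" for x
        by (intro integrable_continuous continuous_intros continuous_on_compose2[OF cont_\<alpha>[of UNIV]] subset_UNIV)
    qed (use cont_A in auto)
    moreover have "(A p has_integral (1 *\<^sub>R \<alpha> (1 *\<^sub>R p) - 0 *\<^sub>R \<alpha> (0 *\<^sub>R p))) {0..1}"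
    proof (rule fundamental_theorem_of_calculus)
      show "((\<lambda>t. t *\<^sub>R \<alpha> (t *\<^sub>R p)) has_vector_derivative A p t) (at t within {0..1})" for t
      proof -
        have "((\<lambda>t. \<alpha> (t *\<^sub>R p)) has_derivative (\<lambda>h. ?D (t *\<^sub>R p) (h *\<^sub>R p))) (at t within {0..1})"
          by (rule has_derivative_compose[OF _ D]) (auto intro!: derivative_eq_intros)
        from has_derivative_scaleR[OF has_derivative_ident this] show ?thesis
          by (simp add: has_vector_derivative_def A_def linear_cmul[OF lin] algebra_simps)
      qed
    qed simp
    ultimately show ?thesis
      by (simp add: integral_unique cbox_interval)
  qed
  \<comment> \<open>One differentiation under the integral is enough, since the derivative found is
    the smooth form \<alpha> itself.\<close>
  have "smooth K"
    using \<alpha> by (intro smooth_onI[OF open_UNIV K'] smooth_intros) auto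
  moreover have "d_fun K = \<alpha>"
    unfolding d_fun_def by (simp add: blinfun_apply_inverse flip: frechet_derivative_at[OF K'])
  ultimately show thesis
    by (rule that)
qed

subsection \<open>Sprays\<close>

definition spray_connection ::
  "((real^'n) \<times> (real^'n) \<Rightarrow> real^'n) \<Rightarrow> (real^'n) \<times> (real^'n) \<Rightarrow> (real^'n) \<Rightarrow>\<^sub>L (real^'n)" where
  "spray_connection G p = Blinfun (\<lambda>u. frechet_derivative G (at p) (0, u))"

lemma spray_connection_apply:
  assumes "smooth G"
  shows "spray_connection G p u = frechet_derivative G (at p) (0, u)"
proof -
  have "bounded_linear (frechet_derivative G (at p))"
    using smooth_on_has_derivative[OF assms, of p] has_derivative_bounded_linear by auto
  then have "bounded_linear (\<lambda>u. frechet_derivative G (at p) (0, u))"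
    by (rule bounded_linear_compose) (intro bounded_linear_intros)
  then show ?thesis
    by (simp add: spray_connection_def bounded_linear_Blinfun_apply)
qed

lemma smooth_spray_connection:
  assumes "smooth G"
  shows "smooth (spray_connection G)"
  by (rule smooth_on_blinfunI)
    (simp_all add: spray_connection_apply[OF assms] smooth_on_frechet_derivative[OF assms])

lemma delta_x_eq_hlift:
  assumes "smooth G"
  shows "delta_x G i p = hlift (spray_connection G) p (axis i 1)"
proof -
  let ?v = "(0, axis i 1)"
  have "frechet_derivative (\<lambda>q. G q $ a) (at p) ?v = frechet_derivative G (at p) ?v $ a" for a
    by (rule fun_cong[OF frechet_derivative_at[symmetric]])
      (intro bounded_linear.has_derivative[OF bounded_linear_vec_nth]
        smooth_on_has_derivative[OF assms] UNIV_I)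
  then show ?thesis
    by (simp add: delta_x_def hlift_def spray_connection_apply[OF assms] vec_eq_iff axis_def
        if_distrib cong: if_cong)
qed

lemma horizontal_eq_hdist:
  fixes G :: "(real^'n) \<times> (real^'n) \<Rightarrow> real^'n"
  assumes "smooth G"
  shows "horizontal G = hdist (spray_connection G)"
proof
  fix p
  have "range (\<lambda>i::'n. axis i (1::real)) = Basis"
    by (auto simp: Basis_vec_def)
  then have "range (\<lambda>i. delta_x G i p) = hlift (spray_connection G) p ` Basis"
    by (simp add: delta_x_eq_hlift[OF assms] image_image flip: \<open>range _ = Basis\<close>)
  then show "horizontal G p = hdist (spray_connection G) p"
    by (simp add: horizontal_def hdist_def linear_span_image[OF linear_hlift])
qed

text \<open>Both sides are the derivative of \<open>G (x, l *\<^sub>R y)\<close> in \<open>l\<close>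
  at 1, by the chain rule and by homogeneity.\<close>

lemma spray_connection_euler:
  assumes "is_spray G"
  shows "spray_connection G (x, y) y = 2 *\<^sub>R G (x, y)"
proof -
  have G: "smooth G" and hom: "\<And>l. l > 0 \<Longrightarrow> G (x, l *\<^sub>R y) = l\<^sup>2 *\<^sub>R G (x, y)"
    using assms by (auto simp: is_spray_def)
  have "((\<lambda>l::real. G (x, l *\<^sub>R y)) has_derivative (\<lambda>h. frechet_derivative G (at (x, y)) (0, h *\<^sub>R y))) (at 1)"
    by (rule has_derivative_compose[where g = G])
      (auto intro!: derivative_eq_intros smooth_on_has_derivative[OF G, of "(x, 1 *\<^sub>R y)", simplified])
  \<comment> \<open>Homogeneity is available only for \<open>l > 0\<close>, an open neighbourhood of
    1, so the derivative is transferred locally.\<close>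
  moreover have "((\<lambda>l::real. G (x, l *\<^sub>R y)) has_derivative (\<lambda>h. (2 * h) *\<^sub>R G (x, y))) (at 1)"
    by (rule has_derivative_transform_within_open[of "\<lambda>l. l\<^sup>2 *\<^sub>R G (x, y)" _ _ _ "{0<..}"])
      (auto simp: hom intro!: derivative_eq_intros)
  ultimately have "(\<lambda>h. frechet_derivative G (at (x, y)) (0, h *\<^sub>R y)) = (\<lambda>h. (2 * h) *\<^sub>R G (x, y))"
    by (rule has_derivative_unique)
  from fun_cong[OF this, of 1] show ?thesis
    by (simp add: spray_connection_apply[OF G])
qed

text \<open>At (x, y) the spray is the horizontal lift of \<open>y\<close>: Euler's relation
  identifies its vertical component \<open>- 2 *\<^sub>R G (x, y)\<close> with \<open>- N y\<close>
  for the spray connection N.\<close>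

lemma is_section_semispray_field:
  assumes "is_spray G"
  shows "is_section (horizontal G) (semispray_field G)"
proof -
  have G: "smooth G"
    using assms by (simp add: is_spray_def)
  have "smooth (\<lambda>p. (snd p, - 2 *\<^sub>R G p))"
    using G by (intro smooth_intros open_UNIV)
  moreover have "semispray_field G = (\<lambda>p. (snd p, - 2 *\<^sub>R G p))"
    by (auto simp: semispray_field_def)
  ultimately show ?thesis
    by (auto simp: is_section_def horizontal_eq_hdist[OF G] mem_hdist_iff spray_connection_euler[OF assms])
qed

lemma R_flat_imp_curvature_free:
  assumes "smooth G" and "R_flat G"
  shows "curvature_free (spray_connection G)"
  unfolding curvature_free_def
proof (intro allI)
  fix p u w
  let ?N = "spray_connection G"
  obtain V and \<phi> :: "real^'a \<Rightarrow> (real^'a) \<times> (real^'a)"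
    where "parametrizes_integral_manifold V \<phi> (hdist ?N)" "p \<in> \<phi> ` V"
    using assms unfolding R_flat_def integrable_distribution_def horizontal_eq_hdist[OF assms(1)]
    by blast
  then show "frechet_derivative ?N (at p) (hlift ?N p u) w = frechet_derivative ?N (at p) (hlift ?N p w) u"
    by (rule curvature_freeI_integral_manifold[OF smooth_spray_connection[OF assms(1)]])
qed

theorem theorem3p1:
  fixes G :: "(real^'n) \<times> (real^'n) \<Rightarrow> real^'n"
    and \<omega> :: "(real^'n) \<times> (real^'n) \<Rightarrow> ((real^'n) \<times> (real^'n)) bilin"
    and \<alpha> :: "(real^'n) \<times> (real^'n) \<Rightarrow> ((real^'n) \<times> (real^'n)) covector"
  assumes "is_spray G"
    and "two_form \<omega>"
    and "closed_one_form \<alpha>"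
    and "is_section (annihilator (horizontal G)) (\<lambda>p. \<alpha> p - contract (semispray_field G) \<omega> p)"
  shows "(\<forall>H. smooth H \<and> d_fun H = \<alpha> \<longrightarrow> constant_of_motion (semispray_field G) H) \<and>
    (R_flat G \<and> closed_two_form \<omega> \<longrightarrow>
      (let L = (\<lambda>p. {(X, \<beta>). X \<in> horizontal G p \<and>
                 \<beta> - blinfun_apply (\<omega> p) X \<in> annihilator (horizontal G) p})
       in dirac_structure L \<and> hamiltonian_wrt L (semispray_field G)))"
proof (intro conjI allI impI)
  let ?S = "semispray_field G"
  have G: "smooth G"
    using assms(1) by (simp add: is_spray_def)
  have S: "is_section (horizontal G) ?S"
    by (rule is_section_semispray_field[OF assms(1)])
  have \<alpha>: "\<alpha> p - \<omega> p (?S p) \<in> annihilator (horizontal G) p" for p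
    using is_section_mem[OF assms(4), of p] by (simp add: contract_def)
  {
    fix H
    assume H: "smooth H \<and> d_fun H = \<alpha>"
    have "lie_fun ?S H p = 0" for p
    proof -
      have "lie_fun ?S H p = \<alpha> p (?S p)"
        using H d_fun_apply[of H p "?S p"] by (simp add: lie_fun_def)
      also have "\<dots> = \<omega> p (?S p) (?S p)"
        using \<alpha>[of p] is_section_mem[OF S, of p] by (auto simp: annihilator_def blinfun.bilinear_simps)
      finally show ?thesis
        using assms(2) unfolding two_form_def by metis
    qed
    then show "constant_of_motion ?S H"
      by (simp add: constant_of_motion_def)
  next
    assume flat: "R_flat G \<and> closed_two_form \<omega>"
    obtain K where K: "smooth K" "d_fun K = \<alpha>"
      using closed_one_form_exact[OF assms(3)] .
    have "dirac_structure (dist_dirac (horizontal G) \<omega>)"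
      unfolding horizontal_eq_hdist[OF G] using G flat
      by (intro dirac_structure_dist_dirac_hdist smooth_spray_connection R_flat_imp_curvature_free)
        auto
    \<comment> \<open>With dK = \<alpha>, the assumption relating \<alpha> to \<omega> is exactly
      the covector condition of the bundle at S.\<close>
    moreover have "is_section (dist_dirac (horizontal G) \<omega>) (\<lambda>p. (?S p, d_fun K p))"
      using S \<alpha> smooth_on_Pair[OF open_UNIV is_section_smooth[OF S] smooth_d_fun[OF K(1)]]
      by (simp add: is_section_def dist_dirac_def K(2))
    ultimately show "let L = (\<lambda>p. {(X, \<beta>). X \<in> horizontal G p \<and>
        \<beta> - blinfun_apply (\<omega> p) X \<in> annihilator (horizontal G) p})
      in dirac_structure L \<and> hamiltonian_wrt L ?S"
      using K(1) by (auto simp: Let_def dist_dirac_def hamiltonian_wrt_def)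
  }
qed

end
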